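(* Let $A$ be a ring and $I$ an ideal of $A$. Then: (1) If $A\bowtie I$ is an ISP-ring, then so is $A$. (2) Assume that $I=aI$ for each regular element $a$ of $A$. Then $A\bowtie I$ is an ISP-ring if and only if $A$ is an ISP-ring.
   Context: All rings are commutative with a nonzero unit. The amalgamated duplication of $A$ along the ideal $I$ is the subring $A\bowtie I=\{(a,a+i) : a\in A,\ i\in I\}$ of $A\times A$. An element of a ring is regular if it is not a zero-divisor; an ideal is regular if it contains at least one regular element. A proper ideal $H$ is a radical ideal if $\sqrt H=H$. An ideal $J$ of $A$ is invertible if $JJ'=A$ for some $A$-submodule $J'$ of the total quotient ring $T(A)$; equivalently, $J$ is finitely generated, regular, and $J_M$ is a principal ideal of $A_M$ for each maximal ideal $M$ of $A$ (the ideal $A$ itself is allowed). A ring is an ISP-ring if every proper regular ideal of it can be written as $JH_1\cdots H_n$ with $J$ an invertible ideal, $n\ge 1$, and all $H_i$ proper radical ideals. *)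

theory Defs
  imports "HOL-Algebra.Module" "HOL-Algebra.Subrings" "HOL-Algebra.Chinese_Remainder"
begin

definition regulars :: "('a, 'm) ring_scheme \<Rightarrow> 'a set"
  where "regulars R =
    {a \<in> carrier R. \<forall>x \<in> carrier R. a \<otimes>\<^bsub>R\<^esub> x = \<zero>\<^bsub>R\<^esub> \<longrightarrow> x = \<zero>\<^bsub>R\<^esub>}"

definition regular_ideal :: "('a, 'm) ring_scheme \<Rightarrow> 'a set \<Rightarrow> bool"
  where "regular_ideal R H \<longleftrightarrow> ideal H R \<and> H \<inter> regulars R \<noteq> {}"

definition radical :: "('a, 'm) ring_scheme \<Rightarrow> 'a set \<Rightarrow> 'a set"
  where "radical R H = {x \<in> carrier R. \<exists>n::nat. n > 0 \<and> x [^]\<^bsub>R\<^esub> n \<in> H}"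

definition radical_ideal :: "('a, 'm) ring_scheme \<Rightarrow> 'a set \<Rightarrow> bool"
  where "radical_ideal R H \<longleftrightarrow> ideal H R \<and> H \<noteq> carrier R \<and> radical R H = H"


section \<open>The total quotient ring\<close>

text \<open>\<open>fraction R a s\<close> is the fraction \<open>a/s\<close>, the class of \<open>(a, s)\<close> in
  \<open>carrier R \<times> regulars R\<close> under cross multiplication. Regular elements can be cancelled, so
  no further multiplier is needed in the relation.\<close>

definition fraction :: "('a, 'm) ring_scheme \<Rightarrow> 'a \<Rightarrow> 'a \<Rightarrow> ('a \<times> 'a) set"
  where "fraction R a s =
    {(b, t). b \<in> carrier R \<and> t \<in> regulars R \<and> a \<otimes>\<^bsub>R\<^esub> t = b \<otimes>\<^bsub>R\<^esub> s}"

text \<open>The total quotient ring is set up as a module over \<open>R\<close>; as records of modules extend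
  records of rings, the same object also serves as a ring. The operations take the union of
  the results over all representatives.\<close>

definition total_quotient :: "('a, 'm) ring_scheme \<Rightarrow> ('a, ('a \<times> 'a) set) module"
  where "total_quotient R =
    \<lparr> carrier = {fraction R a s | a s. a \<in> carrier R \<and> s \<in> regulars R},
      mult = (\<lambda>x y. \<Union>(a, s) \<in> x. \<Union>(b, t) \<in> y. fraction R (a \<otimes>\<^bsub>R\<^esub> b) (s \<otimes>\<^bsub>R\<^esub> t)),
      one = fraction R \<one>\<^bsub>R\<^esub> \<one>\<^bsub>R\<^esub>,
      zero = fraction R \<zero>\<^bsub>R\<^esub> \<one>\<^bsub>R\<^esub>,
      add = (\<lambda>x y. \<Union>(a, s) \<in> x. \<Union>(b, t) \<in> y.
        fraction R (a \<otimes>\<^bsub>R\<^esub> t \<oplus>\<^bsub>R\<^esub> b \<otimes>\<^bsub>R\<^esub> s) (s \<otimes>\<^bsub>R\<^esub> t)),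
      smult = (\<lambda>r x. \<Union>(a, s) \<in> x. fraction R (r \<otimes>\<^bsub>R\<^esub> a) s) \<rparr>"

definition to_total_quotient :: "('a, 'm) ring_scheme \<Rightarrow> 'a \<Rightarrow> ('a \<times> 'a) set"
  where "to_total_quotient R a = fraction R a \<one>\<^bsub>R\<^esub>"

lemma UN_representatives:
  assumes "p \<in> F" "\<And>a s. (a, s) \<in> F \<Longrightarrow> f a s = K"
  shows "(\<Union>(a, s) \<in> F. f a s) = K"
  using assms by (intro UN_constant_eq) auto

context cring
begin

lemma regulars_closed: "a \<in> regulars R \<Longrightarrow> a \<in> carrier R"
  by (simp add: regulars_def)

lemma regular_cancel:
  assumes "s \<in> regulars R" "x \<in> carrier R" "y \<in> carrier R" "s \<otimes> x = s \<otimes> y"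
  shows "x = y"
proof -
  have s: "s \<in> carrier R" using assms by (simp_all add: regulars_closed)
  have "s \<otimes> (x \<ominus> y) = s \<otimes> x \<ominus> s \<otimes> y"
    using s assms(2,3) by (simp add: minus_eq r_distr r_minus)
  also have "\<dots> = \<zero>" using assms s by simp
  finally have "x \<ominus> y = \<zero>" using assms(1-3) unfolding regulars_def by blast
  then show ?thesis using assms by simp
qed

lemma regulars_one: "\<one> \<in> regulars R"
  by (simp add: regulars_def)

lemma regulars_mult: "s \<in> regulars R \<Longrightarrow> t \<in> regulars R \<Longrightarrow> s \<otimes> t \<in> regulars R"
  unfolding regulars_def by clarify (metis m_assoc m_closed mem_Collect_eq)

lemmas regulars_simps = regulars_closed regulars_mult regulars_one

lemma fraction_self: "a \<in> carrier R \<Longrightarrow> s \<in> regulars R \<Longrightarrow> (a, s) \<in> fraction R a s"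
  by (simp add: fraction_def)

lemma fraction_eq_iff:
  assumes "a \<in> carrier R" "s \<in> regulars R" "b \<in> carrier R" "t \<in> regulars R"
  shows "fraction R a s = fraction R b t \<longleftrightarrow> a \<otimes> t = b \<otimes> s"
proof
  assume "fraction R a s = fraction R b t"
  then have "(b, t) \<in> fraction R a s" using fraction_self assms by simp
  then show "a \<otimes> t = b \<otimes> s" by (simp add: fraction_def)
next
  have sub: "fraction R a s \<subseteq> fraction R b t"
    if abst: "a \<in> carrier R" "s \<in> regulars R" "b \<in> carrier R" "t \<in> regulars R"
      and eq: "a \<otimes> t = b \<otimes> s" for a s b t
  proof
    fix p assume "p \<in> fraction R a s"
    then obtain c u where p: "p = (c, u)" and cu: "c \<in> carrier R" "u \<in> regulars R"
      and acu: "a \<otimes> u = c \<otimes> s"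
      by (auto simp: fraction_def)
    have car: "s \<in> carrier R" "t \<in> carrier R" "u \<in> carrier R"
      using abst cu by (simp_all add: regulars_closed)
    have "s \<otimes> (b \<otimes> u) = (b \<otimes> s) \<otimes> u" using car abst by algebra
    also have "\<dots> = (a \<otimes> u) \<otimes> t" unfolding eq[symmetric] using car abst by algebra
    also have "\<dots> = s \<otimes> (c \<otimes> t)" unfolding acu using car cu by algebra
    finally have "b \<otimes> u = c \<otimes> t"
      using regular_cancel[OF abst(2)] car abst cu by simp
    then show "p \<in> fraction R b t" using p cu by (simp add: fraction_def)
  qed
  assume "a \<otimes> t = b \<otimes> s"
  then show "fraction R a s = fraction R b t" using sub[of a s b t] sub[of b t a s] assms by auto
qed

lemma total_quotient_carrier:
  "carrier (total_quotient R) = {fraction R a s | a s. a \<in> carrier R \<and> s \<in> regulars R}"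
  by (simp add: total_quotient_def)

lemma fraction_closed:
  "a \<in> carrier R \<Longrightarrow> s \<in> regulars R \<Longrightarrow> fraction R a s \<in> carrier (total_quotient R)"
  by (auto simp: total_quotient_carrier)

lemma total_quotient_mult:
  assumes "a \<in> carrier R" "s \<in> regulars R" "b \<in> carrier R" "t \<in> regulars R"
  shows "fraction R a s \<otimes>\<^bsub>total_quotient R\<^esub> fraction R b t = fraction R (a \<otimes> b) (s \<otimes> t)"
proof -
  have "fraction R (c \<otimes> d) (u \<otimes> v) = fraction R (a \<otimes> b) (s \<otimes> t)"
    if "(c, u) \<in> fraction R a s" "(d, v) \<in> fraction R b t" for c u d v
  proof -
    have cd: "c \<in> carrier R" "u \<in> regulars R" "d \<in> carrier R" "v \<in> regulars R"
      "a \<otimes> u = c \<otimes> s" "b \<otimes> v = d \<otimes> t"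
      using that by (auto simp: fraction_def)
    have car: "s \<in> carrier R" "t \<in> carrier R" "u \<in> carrier R" "v \<in> carrier R"
      using assms cd by (simp_all add: regulars_closed)
    have "(c \<otimes> d) \<otimes> (s \<otimes> t) = (c \<otimes> s) \<otimes> (d \<otimes> t)" using car cd(1,3) by algebra
    also have "\<dots> = (a \<otimes> u) \<otimes> (b \<otimes> v)" using cd by simp
    also have "\<dots> = (a \<otimes> b) \<otimes> (u \<otimes> v)" using car assms(1,3) by algebra
    finally show ?thesis using assms cd by (subst fraction_eq_iff) (auto simp: regulars_mult)
  qed
  then show ?thesis
    unfolding total_quotient_def monoid.simps ring.simps
    by (intro UN_representatives[OF fraction_self[OF assms(1,2)]]
        UN_representatives[OF fraction_self[OF assms(3,4)]])
qed

lemma total_quotient_add: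
  assumes "a \<in> carrier R" "s \<in> regulars R" "b \<in> carrier R" "t \<in> regulars R"
  shows "fraction R a s \<oplus>\<^bsub>total_quotient R\<^esub> fraction R b t
    = fraction R (a \<otimes> t \<oplus> b \<otimes> s) (s \<otimes> t)"
proof -
  have "fraction R (c \<otimes> v \<oplus> d \<otimes> u) (u \<otimes> v) = fraction R (a \<otimes> t \<oplus> b \<otimes> s) (s \<otimes> t)"
    if "(c, u) \<in> fraction R a s" "(d, v) \<in> fraction R b t" for c u d v
  proof -
    have cd: "c \<in> carrier R" "u \<in> regulars R" "d \<in> carrier R" "v \<in> regulars R"
      "a \<otimes> u = c \<otimes> s" "b \<otimes> v = d \<otimes> t"
      using that by (auto simp: fraction_def)
    have car: "s \<in> carrier R" "t \<in> carrier R" "u \<in> carrier R" "v \<in> carrier R"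
      using assms cd by (simp_all add: regulars_closed)
    have "(c \<otimes> v \<oplus> d \<otimes> u) \<otimes> (s \<otimes> t)
        = (c \<otimes> s) \<otimes> (v \<otimes> t) \<oplus> (d \<otimes> t) \<otimes> (u \<otimes> s)"
      using car cd(1,3) by algebra
    also have "\<dots> = (a \<otimes> u) \<otimes> (v \<otimes> t) \<oplus> (b \<otimes> v) \<otimes> (u \<otimes> s)" using cd by simp
    also have "\<dots> = (a \<otimes> t \<oplus> b \<otimes> s) \<otimes> (u \<otimes> v)" using car assms(1,3) by algebra
    finally show ?thesis
      using assms cd car by (subst fraction_eq_iff) (auto simp: regulars_mult)
  qed
  then show ?thesis
    unfolding total_quotient_def monoid.simps ring.simps
    by (intro UN_representatives[OF fraction_self[OF assms(1,2)]]
        UN_representatives[OF fraction_self[OF assms(3,4)]])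
qed

lemma total_quotient_smult:
  assumes "r \<in> carrier R" "a \<in> carrier R" "s \<in> regulars R"
  shows "r \<odot>\<^bsub>total_quotient R\<^esub> fraction R a s = fraction R (r \<otimes> a) s"
proof -
  have "fraction R (r \<otimes> c) u = fraction R (r \<otimes> a) s" if "(c, u) \<in> fraction R a s" for c u
  proof -
    have cu: "c \<in> carrier R" "u \<in> regulars R" "a \<otimes> u = c \<otimes> s"
      using that by (auto simp: fraction_def)
    have car: "s \<in> carrier R" "u \<in> carrier R" using assms cu by (simp_all add: regulars_closed)
    have "(r \<otimes> c) \<otimes> s = (r \<otimes> a) \<otimes> u"
      using car assms(1,2) cu by (simp add: m_assoc)
    then show ?thesis using assms cu by (subst fraction_eq_iff) auto
  qed
  then show ?thesis
    unfolding total_quotient_def module.simps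
    by (intro UN_representatives[OF fraction_self[OF assms(2,3)]])
qed

lemma total_quotient_one: "\<one>\<^bsub>total_quotient R\<^esub> = fraction R \<one> \<one>"
  and total_quotient_zero: "\<zero>\<^bsub>total_quotient R\<^esub> = fraction R \<zero> \<one>"
  by (simp_all add: total_quotient_def)

lemmas total_quotient_simps =
  fraction_closed total_quotient_mult total_quotient_add total_quotient_smult
  total_quotient_one total_quotient_zero

lemma fraction_eqI:
  assumes "a \<in> carrier R" "s \<in> regulars R" "b \<in> carrier R" "t \<in> regulars R"
    "a \<otimes> t = b \<otimes> s"
  shows "fraction R a s = fraction R b t"
  using assms fraction_eq_iff by blast

lemma total_quotient_is_cring: "cring (total_quotient R)"
proof (rule cringI)
  let ?T = "total_quotient R"
  show "abelian_group ?T"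
  proof (rule abelian_groupI)
    fix x y assume "x \<in> carrier ?T" "y \<in> carrier ?T"
    then obtain a s b t where xy: "x = fraction R a s" "y = fraction R b t"
      and abst: "a \<in> carrier R" "s \<in> regulars R" "b \<in> carrier R" "t \<in> regulars R"
      by (auto simp: total_quotient_carrier)
    have car: "s \<in> carrier R" "t \<in> carrier R" using abst by (simp_all add: regulars_closed)
    show "x \<oplus>\<^bsub>?T\<^esub> y \<in> carrier ?T"
      using xy abst car by (simp add: total_quotient_simps regulars_simps)
    show "x \<oplus>\<^bsub>?T\<^esub> y = y \<oplus>\<^bsub>?T\<^esub> x"
      using xy abst car by (simp add: total_quotient_simps regulars_simps m_comm a_comm)
    fix z assume "z \<in> carrier ?T"
    then obtain d u where z: "z = fraction R d u" and du: "d \<in> carrier R" "u \<in> regulars R"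
      by (auto simp: total_quotient_carrier)
    have u: "u \<in> carrier R" using du by (simp_all add: regulars_closed)
    have "(a \<otimes> t \<oplus> b \<otimes> s) \<otimes> u \<oplus> d \<otimes> (s \<otimes> t)
        = a \<otimes> (t \<otimes> u) \<oplus> (b \<otimes> u \<oplus> d \<otimes> t) \<otimes> s"
      using abst(1,3) car du(1) u by algebra
    then show "x \<oplus>\<^bsub>?T\<^esub> y \<oplus>\<^bsub>?T\<^esub> z = x \<oplus>\<^bsub>?T\<^esub> (y \<oplus>\<^bsub>?T\<^esub> z)"
      using xy z abst car du u by (simp add: total_quotient_simps regulars_simps m_assoc)
  next
    show "\<zero>\<^bsub>?T\<^esub> \<in> carrier ?T"
      by (simp add: total_quotient_simps regulars_simps)
    fix x assume "x \<in> carrier ?T"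
    then obtain a s where x: "x = fraction R a s" and as: "a \<in> carrier R" "s \<in> regulars R"
      by (auto simp: total_quotient_carrier)
    have s: "s \<in> carrier R" using as by (simp_all add: regulars_closed)
    show "\<zero>\<^bsub>?T\<^esub> \<oplus>\<^bsub>?T\<^esub> x = x"
      using x as s by (simp add: total_quotient_simps regulars_simps)
    have "fraction R (\<ominus> a) s \<oplus>\<^bsub>?T\<^esub> x = \<zero>\<^bsub>?T\<^esub>"
      using x as s by (simp add: total_quotient_simps regulars_simps) (rule fraction_eqI; simp add: regulars_simps l_neg l_minus)
    moreover have "fraction R (\<ominus> a) s \<in> carrier ?T"
      using as by (auto simp: total_quotient_carrier)
    ultimately show "\<exists>y \<in> carrier ?T. y \<oplus>\<^bsub>?T\<^esub> x = \<zero>\<^bsub>?T\<^esub>" by blast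
  qed
  show "comm_monoid ?T"
  proof (rule comm_monoidI)
    show "\<one>\<^bsub>?T\<^esub> \<in> carrier ?T"
      by (simp add: total_quotient_simps regulars_simps)
    fix x y assume "x \<in> carrier ?T" "y \<in> carrier ?T"
    then obtain a s b t where xy: "x = fraction R a s" "y = fraction R b t"
      and abst: "a \<in> carrier R" "s \<in> regulars R" "b \<in> carrier R" "t \<in> regulars R"
      by (auto simp: total_quotient_carrier)
    have car: "s \<in> carrier R" "t \<in> carrier R" using abst by (simp_all add: regulars_closed)
    show "x \<otimes>\<^bsub>?T\<^esub> y \<in> carrier ?T"
      using xy abst car by (simp add: total_quotient_simps regulars_simps)
    show "x \<otimes>\<^bsub>?T\<^esub> y = y \<otimes>\<^bsub>?T\<^esub> x"
      using xy abst car by (simp add: total_quotient_simps regulars_simps m_comm)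
    show "\<one>\<^bsub>?T\<^esub> \<otimes>\<^bsub>?T\<^esub> x = x"
      using xy abst car by (simp add: total_quotient_simps regulars_simps)
    fix z assume "z \<in> carrier ?T"
    then obtain d u where z: "z = fraction R d u" and du: "d \<in> carrier R" "u \<in> regulars R"
      by (auto simp: total_quotient_carrier)
    have u: "u \<in> carrier R" using du by (simp_all add: regulars_closed)
    show "x \<otimes>\<^bsub>?T\<^esub> y \<otimes>\<^bsub>?T\<^esub> z = x \<otimes>\<^bsub>?T\<^esub> (y \<otimes>\<^bsub>?T\<^esub> z)"
      using xy z abst car du u by (simp add: total_quotient_simps regulars_simps m_assoc)
  qed
  fix x y z assume "x \<in> carrier ?T" "y \<in> carrier ?T" "z \<in> carrier ?T"
  then obtain a s b t d u where xyz: "x = fraction R a s" "y = fraction R b t" "z = fraction R d u"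
    and abst: "a \<in> carrier R" "s \<in> regulars R" "b \<in> carrier R" "t \<in> regulars R"
      "d \<in> carrier R" "u \<in> regulars R"
    by (auto simp: total_quotient_carrier)
  have car: "s \<in> carrier R" "t \<in> carrier R" "u \<in> carrier R"
    using abst by (simp_all add: regulars_closed)
  have "((a \<otimes> t \<oplus> b \<otimes> s) \<otimes> d) \<otimes> ((s \<otimes> u) \<otimes> (t \<otimes> u))
      = ((a \<otimes> d) \<otimes> (t \<otimes> u) \<oplus> (b \<otimes> d) \<otimes> (s \<otimes> u)) \<otimes> ((s \<otimes> t) \<otimes> u)"
    using abst(1,3,5) car by algebra
  then show "(x \<oplus>\<^bsub>?T\<^esub> y) \<otimes>\<^bsub>?T\<^esub> z = x \<otimes>\<^bsub>?T\<^esub> z \<oplus>\<^bsub>?T\<^esub> y \<otimes>\<^bsub>?T\<^esub> z"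
    using xyz abst car by (simp add: total_quotient_simps regulars_simps) (rule fraction_eqI; simp add: regulars_simps)
qed

lemma total_quotient_is_module: "module R (total_quotient R)"
proof (rule moduleI)
  let ?T = "total_quotient R"
  show "cring R" by (rule is_cring)
  show "abelian_group ?T"
    using total_quotient_is_cring by (simp add: cring_def ring_def)
  fix r x assume r: "r \<in> carrier R" and "x \<in> carrier ?T"
  then obtain a s where x: "x = fraction R a s" and as: "a \<in> carrier R" "s \<in> regulars R"
    by (auto simp: total_quotient_carrier)
  have s: "s \<in> carrier R" using as by (simp_all add: regulars_closed)
  show "r \<odot>\<^bsub>?T\<^esub> x \<in> carrier ?T"
    using r x as by (simp add: total_quotient_simps)
  {
    fix q assume q: "q \<in> carrier R"
    have "(r \<oplus> q) \<otimes> a \<otimes> (s \<otimes> s) = (r \<otimes> a \<otimes> s \<oplus> q \<otimes> a \<otimes> s) \<otimes> s"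
      using r q as(1) s by algebra
    then show "(r \<oplus> q) \<odot>\<^bsub>?T\<^esub> x = r \<odot>\<^bsub>?T\<^esub> x \<oplus>\<^bsub>?T\<^esub> q \<odot>\<^bsub>?T\<^esub> x"
      using r q x as s by (simp add: total_quotient_simps regulars_simps) (rule fraction_eqI; simp add: regulars_simps)
    show "(r \<otimes> q) \<odot>\<^bsub>?T\<^esub> x = r \<odot>\<^bsub>?T\<^esub> (q \<odot>\<^bsub>?T\<^esub> x)"
      using r q x as by (simp add: total_quotient_simps m_assoc)
  }
  fix y assume "y \<in> carrier ?T"
  then obtain b t where y: "y = fraction R b t" and bt: "b \<in> carrier R" "t \<in> regulars R"
    by (auto simp: total_quotient_carrier)
  then show "r \<odot>\<^bsub>?T\<^esub> (x \<oplus>\<^bsub>?T\<^esub> y) = r \<odot>\<^bsub>?T\<^esub> x \<oplus>\<^bsub>?T\<^esub> r \<odot>\<^bsub>?T\<^esub> y"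
    using r x as s by (simp add: total_quotient_simps regulars_simps r_distr m_assoc)
next
  fix x assume "x \<in> carrier (total_quotient R)"
  then show "\<one> \<odot>\<^bsub>total_quotient R\<^esub> x = x"
    by (auto simp: total_quotient_carrier total_quotient_smult)
qed

lemma to_total_quotient_hom: "to_total_quotient R \<in> ring_hom R (total_quotient R)"
  by (rule ring_hom_memI)
    (auto intro: regulars_one simp: to_total_quotient_def total_quotient_simps regulars_one)

lemma to_total_quotient_inj: "inj_on (to_total_quotient R) (carrier R)"
  by (rule inj_onI) (simp add: to_total_quotient_def fraction_eq_iff regulars_one)

lemma to_total_quotient_Units:
  assumes "s \<in> regulars R"
  shows "to_total_quotient R s \<in> Units (total_quotient R)"
proof -
  interpret T: cring "total_quotient R" by (rule total_quotient_is_cring)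
  have "to_total_quotient R s \<otimes>\<^bsub>total_quotient R\<^esub> fraction R \<one> s = \<one>\<^bsub>total_quotient R\<^esub>"
    using assms regulars_closed[OF assms] regulars_one
    by (simp add: to_total_quotient_def total_quotient_simps fraction_eq_iff regulars_mult)
  moreover have "to_total_quotient R s \<in> carrier (total_quotient R)"
      "fraction R \<one> s \<in> carrier (total_quotient R)"
    using assms regulars_closed[OF assms] regulars_one
    by (auto simp: to_total_quotient_def fraction_closed)
  ultimately show ?thesis
    unfolding Units_def using T.m_comm by (intro CollectI conjI) metis+
qed

end


section \<open>Invertible ideals and ISP-rings\<close>

text \<open>The product \<open>J J' = A\<close> is taken inside the total quotient ring: \<open>J\<close> and \<open>A\<close> are
  replaced by their images there, and \<^const>\<open>ideal_prod\<close> yields the finite nonempty sums of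
  products.\<close>

definition invertible_ideal :: "('a, 'm) ring_scheme \<Rightarrow> 'a set \<Rightarrow> bool"
  where "invertible_ideal R J \<longleftrightarrow> ideal J R \<and>
    (\<exists>J'. submodule J' R (total_quotient R) \<and>
      ideal_prod (total_quotient R) (to_total_quotient R ` J) J'
        = to_total_quotient R ` carrier R)"

definition isp_ring :: "('a, 'm) ring_scheme \<Rightarrow> bool"
  where "isp_ring R \<longleftrightarrow> cring R \<and> \<one>\<^bsub>R\<^esub> \<noteq> \<zero>\<^bsub>R\<^esub> \<and>
    (\<forall>L. regular_ideal R L \<and> L \<noteq> carrier R \<longrightarrow>
      (\<exists>J Hs. invertible_ideal R J \<and> Hs \<noteq> [] \<and> (\<forall>H \<in> set Hs. radical_ideal R H) \<and>
        L = foldl (ideal_prod R) J Hs))"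


section \<open>Amalgamated duplication\<close>

definition amalg_dup :: "('a, 'm) ring_scheme \<Rightarrow> 'a set \<Rightarrow> ('a \<times> 'a) ring"  (infix \<open>\<bowtie>\<close> 65)
  where "A \<bowtie> I =
    (RDirProd A A)\<lparr> carrier := {(a, a \<oplus>\<^bsub>A\<^esub> i) | a i. a \<in> carrier A \<and> i \<in> I} \<rparr>"

lemma RDirProd_simps:
  "(a, b) \<otimes>\<^bsub>RDirProd R S\<^esub> (c, d) = (a \<otimes>\<^bsub>R\<^esub> c, b \<otimes>\<^bsub>S\<^esub> d)"
  "(a, b) \<oplus>\<^bsub>RDirProd R S\<^esub> (c, d) = (a \<oplus>\<^bsub>R\<^esub> c, b \<oplus>\<^bsub>S\<^esub> d)"
  "\<one>\<^bsub>RDirProd R S\<^esub> = (\<one>\<^bsub>R\<^esub>, \<one>\<^bsub>S\<^esub>)"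
  "\<zero>\<^bsub>RDirProd R S\<^esub> = (\<zero>\<^bsub>R\<^esub>, \<zero>\<^bsub>S\<^esub>)"
  by (simp_all add: RDirProd_def DirProd_def monoid.defs ring.defs)

lemma (in cring) RDirProd_self_cring: "cring (RDirProd R R)"
proof -
  have "ring (RDirProd R R)" using RDirProd_ring ring_axioms by blast
  then show ?thesis
    by (intro cring.intro comm_monoid.intro comm_monoid_axioms.intro)
      (auto simp: ring_def RDirProd_carrier RDirProd_simps m_comm)
qed

lemma (in cring) amalg_dup_subcring:
  assumes "ideal I R"
  shows "subcring (carrier (R \<bowtie> I)) (RDirProd R R)"
proof -
  interpret I: ideal I R by fact
  interpret D: cring "RDirProd R R"
    by (rule RDirProd_self_cring)
  have eq: "carrier (R \<bowtie> I) = {(a, b). a \<in> carrier R \<and> b \<in> carrier R \<and> b \<ominus> a \<in> I}"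
  proof (rule subset_antisym; rule subsetI)
    fix p assume "p \<in> carrier (R \<bowtie> I)"
    then obtain a i where "p = (a, a \<oplus> i)" "a \<in> carrier R" "i \<in> I"
      by (auto simp: amalg_dup_def)
    moreover have "a \<oplus> i \<ominus> a = i" if "a \<in> carrier R" "i \<in> carrier R" for a i
      using that by algebra
    ultimately show "p \<in> {(a, b). a \<in> carrier R \<and> b \<in> carrier R \<and> b \<ominus> a \<in> I}"
      using I.Icarr by simp
  next
    fix p assume "p \<in> {(a, b). a \<in> carrier R \<and> b \<in> carrier R \<and> b \<ominus> a \<in> I}"
    then obtain a b where p: "p = (a, b)" "a \<in> carrier R" "b \<in> carrier R" "b \<ominus> a \<in> I"
      by auto
    moreover have "b = a \<oplus> (b \<ominus> a)" using p(2,3) by algebra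
    ultimately show "p \<in> carrier (R \<bowtie> I)" by (force simp: amalg_dup_def)
  qed
  have neg: "\<ominus>\<^bsub>RDirProd R R\<^esub> (a, b) = (\<ominus> a, \<ominus> b)"
    if "a \<in> carrier R" "b \<in> carrier R" for a b
    by (rule D.minus_equality)
      (use that in \<open>auto simp: RDirProd_simps RDirProd_carrier l_neg\<close>)
  show ?thesis
  proof (rule D.subcringI', rule D.subringI)
    show "carrier (R \<bowtie> I) \<subseteq> carrier (RDirProd R R)"
      by (auto simp: eq RDirProd_carrier)
    show "\<one>\<^bsub>RDirProd R R\<^esub> \<in> carrier (R \<bowtie> I)"
      using I.zero_closed by (simp add: eq RDirProd_simps minus_eq r_neg)
    fix p q assume "p \<in> carrier (R \<bowtie> I)"
    then obtain a b where p: "p = (a, b)" "a \<in> carrier R" "b \<in> carrier R" "b \<ominus> a \<in> I"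
      by (auto simp: eq)
    have "\<ominus> b \<ominus> (\<ominus> a) = \<ominus> (b \<ominus> a)" using p(2,3) by algebra
    then show "\<ominus>\<^bsub>RDirProd R R\<^esub> p \<in> carrier (R \<bowtie> I)"
      using p I.a_inv_closed by (simp add: eq neg)
    assume "q \<in> carrier (R \<bowtie> I)"
    then obtain c d where q: "q = (c, d)" "c \<in> carrier R" "d \<in> carrier R" "d \<ominus> c \<in> I"
      by (auto simp: eq)
    have "b \<otimes> d \<ominus> a \<otimes> c = b \<otimes> (d \<ominus> c) \<oplus> (b \<ominus> a) \<otimes> c"
      using p(2,3) q(2,3) by algebra
    then show "p \<otimes>\<^bsub>RDirProd R R\<^esub> q \<in> carrier (R \<bowtie> I)"
      using p q I.a_closed I.I_l_closed I.I_r_closed by (simp add: eq RDirProd_simps)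
    have "b \<oplus> d \<ominus> (a \<oplus> c) = (b \<ominus> a) \<oplus> (d \<ominus> c)"
      using p(2,3) q(2,3) by algebra
    then show "p \<oplus>\<^bsub>RDirProd R R\<^esub> q \<in> carrier (R \<bowtie> I)"
      using p q I.a_closed by (simp add: eq RDirProd_simps)
  qed
qed

lemma (in cring) amalg_dup_is_cring:
  assumes "ideal I R"
  shows "cring (R \<bowtie> I)"
proof -
  interpret D: cring "RDirProd R R"
    by (rule RDirProd_self_cring)
  have "(RDirProd R R)\<lparr>carrier := carrier (R \<bowtie> I)\<rparr> = R \<bowtie> I"
    by (simp add: amalg_dup_def)
  then show ?thesis
    using amalg_dup_subcring[OF assms] subcringE(1)[OF amalg_dup_subcring[OF assms]]
      D.subcring_iff by metis
qed

end

(* Both directions transport factorizations along the projection of A \<bowtie> I onto A. Its kernel is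
   {0} \<times> I, it maps regular elements to regular elements, and (a, a) is a regular lift of a
   regular a. A factor of an ideal containing the kernel contains the kernel too, so the images
   of the factors factor the image; this gives (1). If I = a I for all regular a, then every
   regular ideal of A \<bowtie> I contains the kernel, so ideals are determined by their images as
   soon as they are regular and factorizations pull back. Invertibility is transported in
   the form: J K is generated by a regular element for some ideal K. *)
theory Submission
  imports Defs
begin

section \<open>Products of ideals\<close>

context cring
begin

lemma regularsI:
  assumes "a \<in> carrier R" "\<And>x. \<lbrakk> x \<in> carrier R; a \<otimes> x = \<zero> \<rbrakk> \<Longrightarrow> x = \<zero>"
  shows "a \<in> regulars R"
  using assms by (simp add: regulars_def)

lemma regularsD: "\<lbrakk> a \<in> regulars R; x \<in> carrier R; a \<otimes> x = \<zero> \<rbrakk> \<Longrightarrow> x = \<zero>"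
  by (simp add: regulars_def)

lemma regulars_nat_pow: "s \<in> regulars R \<Longrightarrow> s [^] (n::nat) \<in> regulars R"
  by (induction n) (simp_all add: regulars_one regulars_mult)

lemma foldl_ideal_prod_ideal:
  assumes "ideal J R" "\<And>H. H \<in> set Hs \<Longrightarrow> ideal H R"
  shows "ideal (foldl (ideal_prod R) J Hs) R"
  using assms by (induction Hs arbitrary: J) (auto intro: ideal_prod_is_ideal)

text \<open>By induction from \<open>J \<cdot> H \<subseteq> J \<inter> H\<close>. Through this,
  factors inherit a kernel or a regular element from their product.\<close>

lemma foldl_ideal_prod_subset:
  assumes "ideal J R" "\<And>H. H \<in> set Hs \<Longrightarrow> ideal H R"
  shows "foldl (ideal_prod R) J Hs \<subseteq> J" "\<And>H. H \<in> set Hs \<Longrightarrow> foldl (ideal_prod R) J Hs \<subseteq> H"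
proof -
  have "foldl (ideal_prod R) J Hs \<subseteq> J \<and> (\<forall>H \<in> set Hs. foldl (ideal_prod R) J Hs \<subseteq> H)"
    using assms
  proof (induction Hs arbitrary: J)
    case (Cons H Hs)
    have "ideal (J \<cdot> H) R" "J \<cdot> H \<subseteq> J" "J \<cdot> H \<subseteq> H"
      using Cons.prems ideal_prod_is_ideal ideal_prod_inter[of J H] by auto
    then show ?case using Cons.IH[of "J \<cdot> H"] Cons.prems by fastforce
  qed simp
  then show "foldl (ideal_prod R) J Hs \<subseteq> J"
    and "\<And>H. H \<in> set Hs \<Longrightarrow> foldl (ideal_prod R) J Hs \<subseteq> H" by blast+
qed

text \<open>Taking a regular \<open>s\<close> also for \<open>x\<close> exhibits a power of
  \<open>s\<close> in the product, so a product of ideals sharing a regular element is again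
  regular.\<close>

lemma mult_nat_pow_mem_foldl_ideal_prod:
  assumes "s \<in> carrier R" "x \<in> carrier R" "x \<in> J" "\<And>H. H \<in> set Hs \<Longrightarrow> s \<in> H"
  shows "x \<otimes> s [^] length Hs \<in> foldl (ideal_prod R) J Hs"
  using assms(2-)
proof (induction Hs arbitrary: x J)
  case (Cons H Hs)
  have "x \<otimes> s \<in> J \<cdot> H" using Cons.prems by (auto intro: ideal_prod.prod)
  then have "(x \<otimes> s) \<otimes> s [^] length Hs \<in> foldl (ideal_prod R) (J \<cdot> H) Hs"
    using Cons assms(1) by auto
  moreover have "(x \<otimes> s) \<otimes> s [^] length Hs = x \<otimes> s [^] length (H # Hs)"
    using assms(1) Cons.prems by (simp add: m_assoc nat_pow_Suc2[symmetric])
  ultimately show ?case by simp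
qed simp

end

section \<open>Invertible ideals\<close>

context cring
begin

text \<open>Fixing a denominator \<open>t\<close> turns a submodule of the total quotient ring into
  an ordinary ideal, namely the intersection of \<open>t J'\<close> with the ring.\<close>

lemma ideal_denominators:
  assumes "submodule J' R (total_quotient R)" "t \<in> regulars R"
  shows "ideal {k \<in> carrier R. fraction R k t \<in> J'} R"
proof -
  interpret M: module R "total_quotient R" by (rule total_quotient_is_module)
  note J' = M.submoduleE[OF assms(1)]
  have t: "t \<in> carrier R" using assms(2) by (rule regulars_closed)
  have sm: "fraction R (x \<otimes> a) t \<in> J'" if "x \<in> carrier R" "a \<in> carrier R" "fraction R a t \<in> J'"
    for x a
    using J'(4)[OF that(1,3)] total_quotient_smult[OF that(1,2) assms(2)] by simp
  have add: "fraction R (a \<oplus> b) t \<in> J'"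
    if "a \<in> carrier R" "b \<in> carrier R" "fraction R a t \<in> J'" "fraction R b t \<in> J'" for a b
  proof -
    have "fraction R a t \<oplus>\<^bsub>total_quotient R\<^esub> fraction R b t = fraction R (a \<oplus> b) t"
      using that assms(2) t
      by (simp add: total_quotient_add)
        (rule fraction_eqI; simp add: regulars_simps l_distr m_assoc)
    then show ?thesis using J'(5)[OF that(3,4)] by simp
  qed
  \<comment> \<open>Elements of \<open>J'\<close> come with arbitrary denominators. The zero over
    \<open>t\<close> is obtained by multiplying any element by 0 and then changing the
    denominator.\<close>
  obtain x where x: "x \<in> J'" using J'(2) by auto
  then obtain a s where as: "x = fraction R a s" "a \<in> carrier R" "s \<in> regulars R"
    using J'(1) by (auto simp: total_quotient_carrier)
  have zero: "fraction R \<zero> t \<in> J'"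
  proof -
    have "\<zero> \<odot>\<^bsub>total_quotient R\<^esub> x \<in> J'" using J'(4) x by blast
    moreover have "\<zero> \<odot>\<^bsub>total_quotient R\<^esub> x = fraction R \<zero> s"
      using as by (simp add: total_quotient_smult)
    moreover have "fraction R \<zero> s = fraction R \<zero> t"
      using as assms(2) by (intro fraction_eqI) (auto simp: regulars_closed)
    ultimately show ?thesis by simp
  qed
  have neg: "fraction R (\<ominus> a) t \<in> J'" if "a \<in> carrier R" "fraction R a t \<in> J'" for a
    using sm[of "\<ominus> \<one>" a] that by (simp add: l_minus)
  show ?thesis
  proof (rule idealI)
    show "subgroup {k \<in> carrier R. fraction R k t \<in> J'} (add_monoid R)"
      by (rule group.subgroupI) (use zero add neg in \<open>auto simp: add.is_group a_inv_def[symmetric]\<close>)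
  qed (use sm m_comm in \<open>fastforce simp: ring_axioms\<close>)+
qed

text \<open>A criterion inside the ring itself, which can be moved along homomorphisms without
  comparing total quotient rings. An inverse \<open>J'\<close> yields \<open>K\<close> by clearing a
  denominator \<open>t\<close>; conversely \<open>K / t\<close> is an inverse of
  \<open>J\<close>.\<close>

lemma invertible_ideal_iff_prod_principal:
  "invertible_ideal R J \<longleftrightarrow>
    ideal J R \<and> (\<exists>K. ideal K R \<and> (\<exists>t \<in> regulars R. J \<cdot> K = PIdl t))"
proof (rule iffI)
  let ?T = "total_quotient R"
  interpret M: module R ?T by (rule total_quotient_is_module)
  assume "invertible_ideal R J"
  then obtain J' where J: "ideal J R" and J': "submodule J' R ?T"
    and eq: "ideal_prod ?T (to_total_quotient R ` J) J' = to_total_quotient R ` carrier R"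
    by (auto simp: invertible_ideal_def)
  \<comment> \<open>The denominator remains a parameter, because the suitable one is known only
    after 1 has been written as a finite sum of products.\<close>
  define K where "K t = {k \<in> carrier R. fraction R k t \<in> J'}" for t
  have K: "ideal (K t) R" if "t \<in> regulars R" for t
    using ideal_denominators[OF J' that] by (simp add: K_def)
  interpret J: ideal J R by fact
  have JK_carrier: "y \<in> carrier R" if "y \<in> J \<cdot> K t" "t \<in> regulars R" for y t
    using ideal_prod_in_carrier[OF J K] that by auto
  \<comment> \<open>Enlarging the denominator from \<open>t\<close> to \<open>t u\<close> multiplies
    numerators by \<open>u\<close>; this permits adding fractions with different
    denominators.\<close>
  have scale: "y \<otimes> u \<in> J \<cdot> K (t \<otimes> u)"
    if "y \<in> J \<cdot> K t" "t \<in> regulars R" "u \<in> regulars R" for y t u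
    using that(1)
  proof induction
    case (prod i j)
    have [simp]: "t \<in> carrier R" "u \<in> carrier R" "i \<in> carrier R" "j \<in> carrier R"
      using that prod by (auto simp: regulars_closed K_def)
    have "fraction R (j \<otimes> u) (t \<otimes> u) = fraction R j t"
      using that by (intro fraction_eqI) (auto simp: regulars_simps m_assoc m_comm m_lcomm)
    then have "j \<otimes> u \<in> K (t \<otimes> u)" using prod by (simp add: K_def)
    then have "i \<otimes> (j \<otimes> u) \<in> J \<cdot> K (t \<otimes> u)" using prod by (intro ideal_prod.prod)
    then show ?case by (simp add: m_assoc)
  next
    case (sum s1 s2)
    then show ?case using JK_carrier that
      by (simp add: l_distr regulars_closed ideal_prod.sum)
  qed
  have common_denominator: "\<exists>t \<in> regulars R. \<exists>y \<in> J \<cdot> K t. z = fraction R y t"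
    if "z \<in> ideal_prod ?T (to_total_quotient R ` J) J'" for z
    using that
  proof induction
    case (prod i j)
    obtain a where a: "a \<in> J" "i = fraction R a \<one>"
      using prod by (auto simp: to_total_quotient_def)
    obtain k t where k: "j = fraction R k t" "k \<in> carrier R" "t \<in> regulars R"
      using prod M.submoduleE(1)[OF J'] by (auto simp: total_quotient_carrier)
    have "i \<otimes>\<^bsub>?T\<^esub> j = fraction R (a \<otimes> k) t"
      using a k by (simp add: total_quotient_mult regulars_simps)
    moreover have "a \<otimes> k \<in> J \<cdot> K t" using a k prod by (auto simp: K_def intro: ideal_prod.prod)
    ultimately show ?case using k by blast
  next
    case (sum s1 s2)
    then obtain t y u z where tu: "t \<in> regulars R" "u \<in> regulars R"
      and yz: "y \<in> J \<cdot> K t" "z \<in> J \<cdot> K u" and s: "s1 = fraction R y t" "s2 = fraction R z u"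
      by auto
    have "s1 \<oplus>\<^bsub>?T\<^esub> s2 = fraction R (y \<otimes> u \<oplus> z \<otimes> t) (t \<otimes> u)"
      using s tu yz JK_carrier by (simp add: total_quotient_add)
    moreover have "y \<otimes> u \<oplus> z \<otimes> t \<in> J \<cdot> K (t \<otimes> u)"
      using scale[of y t u] scale[of z u t] tu yz m_comm[of u t]
      by (simp add: regulars_closed ideal_prod.sum)
    ultimately show ?case using tu regulars_mult by blast
  qed
  \<comment> \<open>Only the element 1 has to be written with a common denominator:
    \<open>1 = y / t\<close> with \<open>y\<close> in \<open>J \<cdot> K t\<close> forces
    \<open>y = t\<close>, hence \<open>PIdl t \<subseteq> J \<cdot> K t\<close>.\<close>
  have "to_total_quotient R \<one> \<in> ideal_prod ?T (to_total_quotient R ` J) J'"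
    unfolding eq by simp
  then obtain t y where t: "t \<in> regulars R" "y \<in> J \<cdot> K t" "fraction R \<one> \<one> = fraction R y t"
    using common_denominator unfolding to_total_quotient_def by blast
  then have "y = t"
    using JK_carrier by (simp add: fraction_eq_iff regulars_simps)
  \<comment> \<open>For the other inclusion, \<open>i (k / t)\<close> lies in
    \<open>J J' = R\<close>, so \<open>t\<close> divides \<open>i k\<close>.\<close>
  have sub: "y \<in> PIdl t" if "y \<in> J \<cdot> K t" for y
    using that
  proof induction
    case (prod i k)
    then have ik [simp]: "i \<in> carrier R" "k \<in> carrier R" by (auto simp: K_def)
    have "to_total_quotient R i \<otimes>\<^bsub>?T\<^esub> fraction R k t \<in> to_total_quotient R ` carrier R"
      unfolding eq[symmetric] using prod by (intro ideal_prod.prod) (auto simp: K_def)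
    then obtain r where "r \<in> carrier R" "fraction R (i \<otimes> k) t = fraction R r \<one>"
      using t by (auto simp: to_total_quotient_def total_quotient_mult regulars_simps)
    then have "r \<in> carrier R" "i \<otimes> k = r \<otimes> t"
      using t by (auto simp: fraction_eq_iff regulars_simps)
    then show ?case by (auto simp: cgenideal_def)
  next
    case (sum s1 s2)
    then show ?case
      using cgenideal_ideal[of t] t
      by (meson additive_subgroup.a_closed ideal.axioms(1) regulars_closed)
  qed
  have "J \<cdot> K t = PIdl t"
    using sub t \<open>y = t\<close> cgenideal_minimal[OF ideal_prod_is_ideal[OF J K]] by blast
  then show "ideal J R \<and> (\<exists>K. ideal K R \<and> (\<exists>t \<in> regulars R. J \<cdot> K = PIdl t))"
    using J K t by blast
next
  let ?T = "total_quotient R"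
  interpret M: module R ?T by (rule total_quotient_is_module)
  assume "ideal J R \<and> (\<exists>K. ideal K R \<and> (\<exists>t \<in> regulars R. J \<cdot> K = PIdl t))"
  then obtain K t where J: "ideal J R" and K: "ideal K R" and t: "t \<in> regulars R"
    and eq: "J \<cdot> K = PIdl t" by blast
  interpret J: ideal J R by fact
  interpret K: ideal K R by fact
  have t' [simp]: "t \<in> carrier R" using t by (rule regulars_closed)
  \<comment> \<open>The candidate inverse \<open>K / t\<close>.\<close>
  define J' where "J' = (\<lambda>k. fraction R k t) ` K"
  have add: "fraction R a t \<oplus>\<^bsub>?T\<^esub> fraction R b t = fraction R (a \<oplus> b) t"
    if "a \<in> carrier R" "b \<in> carrier R" for a b
    using that t
    by (simp add: total_quotient_add)
      (rule fraction_eqI; simp add: regulars_simps l_distr m_assoc)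
  have zero: "fraction R \<zero> t = \<zero>\<^bsub>?T\<^esub>"
    unfolding total_quotient_zero using t by (intro fraction_eqI) (auto simp: regulars_one)
  have sub: "submodule J' R ?T"
  proof (rule M.submoduleI)
    show "J' \<subseteq> carrier ?T" using t by (auto simp: J'_def fraction_closed)
    show "\<zero>\<^bsub>?T\<^esub> \<in> J'" using K.zero_closed zero by (force simp: J'_def)
    fix a assume "a \<in> J'"
    then obtain k where k: "k \<in> K" "a = fraction R k t" by (auto simp: J'_def)
    have "\<ominus>\<^bsub>?T\<^esub> a = fraction R (\<ominus> k) t"
      using k t by (intro M.minus_equality) (auto simp: add zero l_neg fraction_closed)
    then show "\<ominus>\<^bsub>?T\<^esub> a \<in> J'" using k by (auto simp: J'_def)
    { fix b assume "b \<in> J'"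
      then show "a \<oplus>\<^bsub>?T\<^esub> b \<in> J'" using k by (auto simp: J'_def add) }
    fix r assume "r \<in> carrier R"
    then show "r \<odot>\<^bsub>?T\<^esub> a \<in> J'" using k t
      by (auto simp: J'_def total_quotient_smult K.I_l_closed)
  qed
  have "z \<in> to_total_quotient R ` carrier R"
    if "z \<in> ideal_prod ?T (to_total_quotient R ` J) J'" for z
    using that
  proof induction
    case (prod i j)
    then obtain a k where ak: "a \<in> J" "k \<in> K" "i = fraction R a \<one>" "j = fraction R k t"
      by (auto simp: J'_def to_total_quotient_def)
    have "a \<otimes> k \<in> PIdl t" unfolding eq[symmetric] using ak by (auto intro: ideal_prod.prod)
    then obtain r where r: "r \<in> carrier R" "a \<otimes> k = r \<otimes> t" by (auto simp: cgenideal_def)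
    have "i \<otimes>\<^bsub>?T\<^esub> j = fraction R (r \<otimes> t) t"
      using ak t r by (simp add: total_quotient_mult regulars_simps)
    also have "\<dots> = fraction R r \<one>" using r t by (intro fraction_eqI) (auto simp: regulars_one)
    finally show ?case using r by (auto simp: to_total_quotient_def)
  next
    case (sum s1 s2)
    then obtain a b where "a \<in> carrier R" "b \<in> carrier R"
      "s1 = to_total_quotient R a" "s2 = to_total_quotient R b" by auto
    then have "a \<oplus> b \<in> carrier R" "s1 \<oplus>\<^bsub>?T\<^esub> s2 = to_total_quotient R (a \<oplus> b)"
      using ring_hom_add[OF to_total_quotient_hom] by auto
    then show ?case by blast
  qed
  \<comment> \<open>Dividing \<open>J \<cdot> K\<close> by \<open>t\<close> lands in
    \<open>J J'\<close>. Since \<open>r t\<close> lies in \<open>PIdl t = J \<cdot> K\<close>, every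
    \<open>r = (r t) / t\<close> of the ring is reached.\<close>
  moreover have mem: "fraction R y t \<in> ideal_prod ?T (to_total_quotient R ` J) J'"
    if "y \<in> J \<cdot> K" for y
    using that
  proof induction
    case (prod i j)
    have "to_total_quotient R i \<otimes>\<^bsub>?T\<^esub> fraction R j t = fraction R (i \<otimes> j) t"
      using prod t by (simp add: to_total_quotient_def total_quotient_mult regulars_simps)
    then show ?case using prod by (metis J'_def ideal_prod.prod image_eqI)
  next
    case (sum s1 s2)
    have "s1 \<in> carrier R" "s2 \<in> carrier R"
      using sum ideal_prod_in_carrier[OF J K] by auto
    then show ?case using sum ideal_prod.sum add by metis
  qed
  have "to_total_quotient R r \<in> ideal_prod ?T (to_total_quotient R ` J) J'"
    if "r \<in> carrier R" for r
  proof -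
    have "fraction R (r \<otimes> t) t = to_total_quotient R r"
      unfolding to_total_quotient_def using that t by (intro fraction_eqI) (auto simp: regulars_one)
    moreover have "r \<otimes> t \<in> J \<cdot> K" unfolding eq using that by (auto simp: cgenideal_def)
    ultimately show ?thesis using mem by metis
  qed
  ultimately have "ideal_prod ?T (to_total_quotient R ` J) J' = to_total_quotient R ` carrier R"
    by blast
  then show "invertible_ideal R J" using J sub by (auto simp: invertible_ideal_def)
qed

end

section \<open>Surjections lifting regular elements\<close>

text \<open>Isolates what the argument uses of the projection from the duplication. A surjection
  need not preserve regular elements, nor need regular elements have regular preimages, so both are
  assumed.\<close>

locale regular_surjection = ring_hom_cring +
  assumes surj: "h ` carrier R = carrier S"
    and hom_regular: "s \<in> regulars R \<Longrightarrow> h s \<in> regulars S"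
    and lift_regular: "t \<in> regulars S \<Longrightarrow> \<exists>s \<in> regulars R. h s = t"
begin

section \<open>Images and preimages of ideals under the surjection\<close>

abbreviation pre :: "'c set \<Rightarrow> 'a set"
  where "pre K \<equiv> {r \<in> carrier R. h r \<in> K}"

lemma img_pre: "K \<subseteq> carrier S \<Longrightarrow> h ` pre K = K"
  using surj by auto

text \<open>If \<open>h x = h y\<close> with \<open>y\<close> in \<open>H\<close>, then
  \<open>x - y\<close> lies in the kernel, hence in \<open>H\<close>, and so does \<open>x\<close>.
  Ideals above the kernel are thus determined by their images.\<close>

lemma pre_img:
  assumes "ideal H R" "a_kernel R S h \<subseteq> H"
  shows "pre (h ` H) = H"
proof -
  interpret H: ideal H R by fact
  have "x \<in> H" if x: "x \<in> carrier R" "y \<in> H" "h x = h y" for x y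
  proof -
    have "h (x \<ominus> y) = \<zero>\<^bsub>S\<^esub>" using x by (simp add: R.minus_eq S.r_neg)
    moreover have "x \<ominus> y \<in> carrier R" using x by simp
    ultimately have "x \<ominus> y \<in> a_kernel R S h" unfolding a_kernel_def' by blast
    then have "x \<ominus> y \<in> H" using assms(2) by blast
    moreover have "(x \<ominus> y) \<oplus> y = x" using x by (simp add: R.minus_eq R.a_assoc R.l_neg)
    ultimately show ?thesis using H.a_closed[of "x \<ominus> y" y] x by simp
  qed
  then show ?thesis by (intro equalityI subsetI) (use H.Icarr in blast)+
qed

lemma img_ideal:
  assumes "ideal H R"
  shows "ideal (h ` H) S"
proof -
  interpret H: ideal H R by fact
  show ?thesis
  proof (rule idealI)
    show "subgroup (h ` H) (add_monoid S)"
    proof (rule S.add.subgroupI)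
      show "h ` H \<noteq> {}" using H.zero_closed by blast
      fix a assume "a \<in> h ` H"
      then obtain x where x: "x \<in> H" "a = h x" by auto
      then have "\<ominus>\<^bsub>S\<^esub> a = h (\<ominus> x)" by simp
      then show "\<ominus>\<^bsub>S\<^esub> a \<in> h ` H" using x by blast
      fix b assume "b \<in> h ` H"
      then obtain y where y: "y \<in> H" "b = h y" by auto
      then have "a \<oplus>\<^bsub>S\<^esub> b = h (x \<oplus> y)" using x by simp
      then show "a \<oplus>\<^bsub>S\<^esub> b \<in> h ` H" using x y by blast
    qed auto
    fix a x assume "a \<in> h ` H" "x \<in> carrier S"
    then obtain b y where yb: "b \<in> H" "a = h b" "y \<in> carrier R" "x = h y"
      using surj by blast
    then have "x \<otimes>\<^bsub>S\<^esub> a = h (y \<otimes> b)" "a \<otimes>\<^bsub>S\<^esub> x = h (b \<otimes> y)" by simp_all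
    moreover have "y \<otimes> b \<in> H" "b \<otimes> y \<in> H" using yb H.I_l_closed H.I_r_closed by blast+
    ultimately show "x \<otimes>\<^bsub>S\<^esub> a \<in> h ` H" "a \<otimes>\<^bsub>S\<^esub> x \<in> h ` H" by blast+
  qed (rule S.ring_axioms)
qed

lemma img_ideal_prod:
  assumes "ideal J R" "ideal K R"
  shows "h ` (ideal_prod R J K) = ideal_prod S (h ` J) (h ` K)"
proof -
  interpret J: ideal J R by fact
  interpret K: ideal K R by fact
  have "h z \<in> ideal_prod S (h ` J) (h ` K)" if "z \<in> ideal_prod R J K" for z
    using that
  proof induction
    case (prod i j)
    then show ?case by (auto intro: ideal_prod.prod)
  next
    case (sum s1 s2)
    then have "s1 \<in> carrier R" "s2 \<in> carrier R"
      using R.ideal_prod_in_carrier[OF assms] by auto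
    then show ?case using sum by (auto intro: ideal_prod.sum)
  qed
  moreover have "z \<in> h ` (ideal_prod R J K)" if "z \<in> ideal_prod S (h ` J) (h ` K)" for z
    using that
  proof induction
    case (prod i j)
    then obtain a b where ab: "a \<in> J" "b \<in> K" "i = h a" "j = h b" by auto
    then have "i \<otimes>\<^bsub>S\<^esub> j = h (a \<otimes> b)" by simp
    then show ?case using ab by (metis ideal_prod.prod image_eqI)
  next
    case (sum s1 s2)
    then obtain a b where ab: "a \<in> ideal_prod R J K" "b \<in> ideal_prod R J K" "s1 = h a" "s2 = h b"
      by auto
    then have "a \<in> carrier R" "b \<in> carrier R"
      using R.ideal_prod_in_carrier[OF assms] by auto
    then have "s1 \<oplus>\<^bsub>S\<^esub> s2 = h (a \<oplus> b)" using ab by simp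
    then show ?case using ab by (auto intro: ideal_prod.sum)
  qed
  ultimately show ?thesis by blast
qed

lemma img_foldl_ideal_prod:
  assumes "ideal J R" "\<And>H. H \<in> set Hs \<Longrightarrow> ideal H R"
  shows "h ` foldl (ideal_prod R) J Hs = foldl (ideal_prod S) (h ` J) (map ((`) h) Hs)"
  using assms
  by (induction Hs arbitrary: J) (auto simp: img_ideal_prod R.ideal_prod_is_ideal)

lemma img_cgenideal:
  assumes "t \<in> carrier R"
  shows "h ` cgenideal R t = cgenideal S (h t)"
proof -
  have "h ` cgenideal R t = (\<lambda>x. x \<otimes>\<^bsub>S\<^esub> h t) ` (h ` carrier R)"
    using assms by (force simp: cgenideal_def)
  then show ?thesis unfolding surj by (auto simp: cgenideal_def)
qed

text \<open>The relation \<open>J K = (t)\<close> is mapped to \<open>h(J) h(K) = (h t)\<close>, and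
  \<open>h t\<close> is still regular.\<close>

lemma img_invertible_ideal:
  assumes "invertible_ideal R J"
  shows "invertible_ideal S (h ` J)"
proof -
  obtain K t where J: "ideal J R" and K: "ideal K R" and t: "t \<in> regulars R"
    and "ideal_prod R J K = cgenideal R t"
    using assms unfolding R.invertible_ideal_iff_prod_principal by auto
  then have "ideal_prod S (h ` J) (h ` K) = cgenideal S (h t)"
    by (metis img_cgenideal img_ideal_prod R.regulars_closed)
  then show ?thesis
    unfolding S.invertible_ideal_iff_prod_principal
    using img_ideal J K t hom_regular by blast
qed

lemma img_radical_ideal:
  assumes "radical_ideal R H" "a_kernel R S h \<subseteq> H"
  shows "radical_ideal S (h ` H)"
proof -
  have H: "ideal H R" "H \<noteq> carrier R" "radical R H = H"
    using assms by (auto simp: radical_ideal_def)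
  note pre = pre_img[OF H(1) assms(2)]
  have "y \<in> h ` H" if y: "y \<in> carrier S" "n > 0" "y [^]\<^bsub>S\<^esub> n \<in> h ` H" for y and n :: nat
  proof -
    obtain x where x: "x \<in> carrier R" "y = h x" using y surj by auto
    then have "x [^] n \<in> pre (h ` H)" using y by simp
    then have "x \<in> radical R H" using pre x y by (auto simp: radical_def)
    then show ?thesis using H x by simp
  qed
  moreover have "y [^]\<^bsub>S\<^esub> (1::nat) = y" if "y \<in> h ` H" for y
    using that ideal.Icarr[OF H(1)] by auto
  ultimately have "radical S (h ` H) = h ` H"
    using ideal.Icarr[OF img_ideal[OF H(1)]] unfolding radical_def
    by (intro equalityI subsetI) (auto intro!: exI[of _ "1::nat"])
  moreover have "h ` H \<noteq> carrier S" using pre H(2) by auto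
  ultimately show ?thesis using img_ideal H by (auto simp: radical_ideal_def)
qed

lemma pre_radical_ideal:
  assumes "radical_ideal S H"
  shows "radical_ideal R (pre H)"
proof -
  have H: "ideal H S" "H \<noteq> carrier S" "radical S H = H"
    using assms by (auto simp: radical_ideal_def)
  have "ideal (pre H) R" using ring.ideal_vimage[OF H(1)] by simp
  moreover have "pre H \<noteq> carrier R"
    using H(2) img_pre[of H] surj ideal.Icarr[OF H(1)] by fastforce
  moreover have "radical R (pre H) = pre H"
  proof (intro equalityI subsetI)
    fix x assume "x \<in> radical R (pre H)"
    then have "x \<in> carrier R" "h x \<in> radical S H" by (auto simp: radical_def)
    then show "x \<in> pre H" using H by simp
  next
    fix x assume "x \<in> pre H"
    then show "x \<in> radical R (pre H)" by (auto simp: radical_def intro!: exI[of _ "1::nat"])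
  qed
  ultimately show ?thesis by (simp add: radical_ideal_def)
qed

lemma isp_ring_img:
  assumes "isp_ring R" "\<one>\<^bsub>S\<^esub> \<noteq> \<zero>\<^bsub>S\<^esub>"
  shows "isp_ring S"
  unfolding isp_ring_def
proof (intro conjI allI impI; (elim conjE)?)
  fix L assume L: "regular_ideal S L" "L \<noteq> carrier S"
  then have Li: "ideal L S" by (simp add: regular_ideal_def)
  have img: "h ` pre L = L" using img_pre ideal.Icarr[OF Li] by blast
  \<comment> \<open>A regular element of \<open>L\<close> has a regular lift, which lies in the
    preimage.\<close>
  have "pre L \<inter> regulars R \<noteq> {}"
    using L lift_regular R.regulars_closed unfolding regular_ideal_def by fastforce
  then have "regular_ideal R (pre L)" "pre L \<noteq> carrier R"
    using ring.ideal_vimage[OF Li] img L surj by (auto simp: regular_ideal_def)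
  then obtain J Hs where J: "invertible_ideal R J" and "Hs \<noteq> []"
    and Hs: "\<forall>H \<in> set Hs. radical_ideal R H" and eq: "pre L = foldl (ideal_prod R) J Hs"
    using assms(1) unfolding isp_ring_def by blast
  have ideals: "ideal J R" "\<And>H. H \<in> set Hs \<Longrightarrow> ideal H R"
    using J Hs by (auto simp: invertible_ideal_def radical_ideal_def)
  \<comment> \<open>The preimage contains the kernel, and each factor contains the product; this is
    what \<open>img_radical_ideal\<close> asks of the factors.\<close>
  have "a_kernel R S h \<subseteq> pre L"
    using additive_subgroup.zero_closed[OF ideal.axioms(1)[OF Li]] unfolding a_kernel_def' by auto
  then have "a_kernel R S h \<subseteq> H" if "H \<in> set Hs" for H
    using R.foldl_ideal_prod_subset(2)[OF ideals that] unfolding eq by (rule subset_trans)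
  then have "radical_ideal S (h ` H)" if "H \<in> set Hs" for H
    using img_radical_ideal Hs that by blast
  moreover have "L = foldl (ideal_prod S) (h ` J) (map ((`) h) Hs)"
    using img img_foldl_ideal_prod[OF ideals] eq by simp
  moreover have "\<forall>H \<in> set (map ((`) h) Hs). radical_ideal S H" "map ((`) h) Hs \<noteq> []"
    using calculation(1) \<open>Hs \<noteq> []\<close> by simp_all
  ultimately show "\<exists>J Hs. invertible_ideal S J \<and> Hs \<noteq> [] \<and> (\<forall>H \<in> set Hs. radical_ideal S H) \<and>
      L = foldl (ideal_prod S) J Hs"
    using img_invertible_ideal[OF J] by blast
qed (use assms S.is_cring in auto)

section \<open>Pulling factorizations back when every regular ideal contains the kernel\<close>

context
  assumes kernel_subset: "\<And>L. regular_ideal R L \<Longrightarrow> a_kernel R S h \<subseteq> L"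
begin

text \<open>Both ideals contain the kernel, so each is the preimage of the common image. Equations
  between regular ideals can therefore be checked in \<open>S\<close>.\<close>

lemma regular_ideal_eqI:
  assumes "regular_ideal R K" "regular_ideal R L" "h ` K = h ` L"
  shows "K = L"
proof -
  have "ideal K R" "ideal L R" using assms(1,2) by (simp_all add: regular_ideal_def)
  then have "pre (h ` K) = K" "pre (h ` L) = L"
    using assms(1,2) pre_img kernel_subset by blast+
  then show ?thesis unfolding assms(3) by (rule subst)
qed

text \<open>With a regular lift \<open>s\<close> of \<open>t\<close>, the product of the two
  preimages and the ideal generated by \<open>s\<close> are regular with equal images, hence
  equal.\<close>

lemma pre_invertible_ideal:
  assumes "invertible_ideal S J"
  shows "invertible_ideal R (pre J)"
proof -
  obtain K t where J: "ideal J S" and K: "ideal K S" and t: "t \<in> regulars S"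
    and eq: "ideal_prod S J K = cgenideal S t"
    using assms unfolding S.invertible_ideal_iff_prod_principal by auto
  obtain s where s: "s \<in> regulars R" "h s = t" using lift_regular t by blast
  have s': "s \<in> carrier R" using s R.regulars_closed by blast
  have pre: "ideal (pre J) R" "ideal (pre K) R" using ring.ideal_vimage J K by auto
  have img: "h ` pre J = J" "h ` pre K = K" using ideal.Icarr[OF J] ideal.Icarr[OF K]
    by (intro img_pre subsetI; blast)+
  \<comment> \<open>As \<open>t\<close> lies in both \<open>J\<close> and \<open>K\<close>, its lift
    \<open>s\<close> lies in both preimages, and the regular element \<open>s \<otimes> s\<close>
    lies in their product.\<close>
  have "t \<in> ideal_prod S J K" unfolding eq using S.cgenideal_self S.regulars_closed t by blast
  then have "s \<in> pre J" "s \<in> pre K" using S.ideal_prod_inter[OF J K] s s' by auto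
  then have "s \<otimes> s \<in> ideal_prod R (pre J) (pre K)" by (rule ideal_prod.prod)
  then have "regular_ideal R (ideal_prod R (pre J) (pre K))"
    using R.ideal_prod_is_ideal[OF pre] R.regulars_mult s by (auto simp: regular_ideal_def)
  moreover have "regular_ideal R (cgenideal R s)"
    using R.cgenideal_ideal R.cgenideal_self s s' by (auto simp: regular_ideal_def)
  moreover have "h ` ideal_prod R (pre J) (pre K) = h ` cgenideal R s"
    using img_ideal_prod[OF pre] img eq img_cgenideal[OF s'] s by simp
  ultimately have "ideal_prod R (pre J) (pre K) = cgenideal R s" by (rule regular_ideal_eqI)
  then show ?thesis unfolding R.invertible_ideal_iff_prod_principal using pre s by blast
qed

text \<open>The image of \<open>L\<close> is factored in \<open>S\<close>, and the preimages of the
  factors multiply to a regular ideal with the same image as \<open>L\<close>, hence to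
  \<open>L\<close>.\<close>

lemma isp_ring_pre:
  assumes "isp_ring S"
  shows "isp_ring R"
  unfolding isp_ring_def
proof (intro conjI allI impI; (elim conjE)?)
  show "\<one> \<noteq> \<zero>" using assms hom_one hom_zero unfolding isp_ring_def by metis
next
  fix L assume L: "regular_ideal R L" "L \<noteq> carrier R"
  then obtain s where Li: "ideal L R" and s: "s \<in> L" "s \<in> regulars R"
    by (auto simp: regular_ideal_def)
  have s': "s \<in> carrier R" using s R.regulars_closed by blast
  have pre: "pre (h ` L) = L" using pre_img[OF Li kernel_subset[OF L(1)]] .
  have "regular_ideal S (h ` L)" "h ` L \<noteq> carrier S"
    using img_ideal[OF Li] hom_regular s pre L(2) by (auto simp: regular_ideal_def)
  then obtain J Hs where J: "invertible_ideal S J" and "Hs \<noteq> []"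
    and Hs: "\<forall>H \<in> set Hs. radical_ideal S H" and eq: "h ` L = foldl (ideal_prod S) J Hs"
    using assms unfolding isp_ring_def by blast
  have ideals: "ideal J S" "\<And>H. H \<in> set Hs \<Longrightarrow> ideal H S"
    using J Hs by (auto simp: invertible_ideal_def radical_ideal_def)
  have pre_ideals: "ideal (pre J) R" "\<And>H. H \<in> set (map pre Hs) \<Longrightarrow> ideal H R"
    using ideals ring.ideal_vimage by auto
  let ?P = "foldl (ideal_prod R) (pre J) (map pre Hs)"
  \<comment> \<open>Each factor in \<open>S\<close> contains \<open>h s\<close>, so each preimage
    contains \<open>s\<close> and \<open>?P\<close> contains a power of this regular
    element.\<close>
  have "h s \<in> J" "\<And>H. H \<in> set Hs \<Longrightarrow> h s \<in> H"
    using s eq S.foldl_ideal_prod_subset[OF ideals] by blast+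
  then have "s \<otimes> s [^] length (map pre Hs) \<in> ?P"
    using s' by (intro R.mult_nat_pow_mem_foldl_ideal_prod) auto
  then have "regular_ideal R ?P"
    using R.foldl_ideal_prod_ideal[OF pre_ideals] s R.regulars_mult R.regulars_nat_pow
    unfolding regular_ideal_def by blast
  moreover have "h ` ?P = h ` L"
  proof -
    have "h ` pre J = J" "map ((`) h) (map pre Hs) = Hs"
      using ideals ideal.Icarr by (fastforce intro!: map_idI img_pre simp: comp_def)+
    then show ?thesis by (simp only: img_foldl_ideal_prod[OF pre_ideals] eq)
  qed
  ultimately have "L = ?P" using regular_ideal_eqI L(1) by blast
  then show "\<exists>J Hs. invertible_ideal R J \<and> Hs \<noteq> [] \<and> (\<forall>H \<in> set Hs. radical_ideal R H) \<and>
      L = foldl (ideal_prod R) J Hs"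
    using pre_invertible_ideal[OF J] pre_radical_ideal Hs \<open>Hs \<noteq> []\<close>
    by (intro exI[of _ "pre J"] exI[of _ "map pre Hs"]) auto
qed (rule R.is_cring)

end

end

section \<open>The projection of the amalgamated duplication\<close>

lemma amalg_dup_simps:
  "(a, b) \<otimes>\<^bsub>A \<bowtie> I\<^esub> (c, d) = (a \<otimes>\<^bsub>A\<^esub> c, b \<otimes>\<^bsub>A\<^esub> d)"
  "(a, b) \<oplus>\<^bsub>A \<bowtie> I\<^esub> (c, d) = (a \<oplus>\<^bsub>A\<^esub> c, b \<oplus>\<^bsub>A\<^esub> d)"
  "\<one>\<^bsub>A \<bowtie> I\<^esub> = (\<one>\<^bsub>A\<^esub>, \<one>\<^bsub>A\<^esub>)"
  "\<zero>\<^bsub>A \<bowtie> I\<^esub> = (\<zero>\<^bsub>A\<^esub>, \<zero>\<^bsub>A\<^esub>)"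
  by (simp_all add: amalg_dup_def RDirProd_simps)

context cring
begin

lemma amalg_dup_carrierE:
  assumes "p \<in> carrier (R \<bowtie> I)"
  obtains a i where "p = (a, a \<oplus> i)" "a \<in> carrier R" "i \<in> I"
  using assms by (auto simp: amalg_dup_def)

lemma amalg_dup_carrierI: "\<lbrakk> a \<in> carrier R; i \<in> I \<rbrakk> \<Longrightarrow> (a, a \<oplus> i) \<in> carrier (R \<bowtie> I)"
  by (auto simp: amalg_dup_def)

lemma amalg_dup_mem:
  assumes "ideal I R"
  shows "a \<in> carrier R \<Longrightarrow> (a, a) \<in> carrier (R \<bowtie> I)"
    and "i \<in> I \<Longrightarrow> (\<zero>, i) \<in> carrier (R \<bowtie> I)"
    and "i \<in> I \<Longrightarrow> (i, \<zero>) \<in> carrier (R \<bowtie> I)"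
proof -
  interpret I: ideal I R by fact
  show "a \<in> carrier R \<Longrightarrow> (a, a) \<in> carrier (R \<bowtie> I)"
    using amalg_dup_carrierI[of a \<zero> I] by simp
  show "i \<in> I \<Longrightarrow> (\<zero>, i) \<in> carrier (R \<bowtie> I)"
    using amalg_dup_carrierI[of \<zero> i I] by simp
  show "i \<in> I \<Longrightarrow> (i, \<zero>) \<in> carrier (R \<bowtie> I)"
    using amalg_dup_carrierI[of i "\<ominus> i" I] by (simp add: r_neg)
qed

text \<open>If \<open>a x = 0\<close>, then \<open>(a, b)\<close> kills \<open>(x j, 0)\<close> for \<open>j \<in> I\<close>, so \<open>x\<close> annihilates \<open>I\<close>; as
  \<open>b - a \<in> I\<close>, also \<open>b x = 0\<close> and \<open>(a, b)\<close> kills \<open>(x, x)\<close>.\<close>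

lemma amalg_dup_regular:
  assumes I: "ideal I R" and s: "(a, b) \<in> regulars (R \<bowtie> I)"
  shows "a \<in> regulars R" "b \<in> regulars R"
proof -
  interpret I: ideal I R by fact
  interpret D: cring "R \<bowtie> I" by (rule amalg_dup_is_cring[OF I])
  obtain i where ab: "a \<in> carrier R" "b = a \<oplus> i" "i \<in> I"
    using D.regulars_closed[OF s] by (auto elim: amalg_dup_carrierE)
  then have b: "b \<in> carrier R" by simp
  note carr [simp] = ab(1) b I.Icarr
  \<comment> \<open>The disjunction lets one argument serve both coordinates: once \<open>x\<close>
    annihilates \<open>I\<close>, being killed by \<open>a\<close> and being killed by
    \<open>b\<close> are equivalent.\<close>
  have ann: "x = \<zero>" if x: "x \<in> carrier R"
    and "\<And>j. j \<in> I \<Longrightarrow> x \<otimes> j = \<zero>" and "a \<otimes> x = \<zero> \<or> b \<otimes> x = \<zero>" for x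
  proof -
    have "i \<otimes> x = \<zero>" using that ab m_comm by auto
    moreover have "b \<otimes> x = a \<otimes> x \<oplus> i \<otimes> x" using ab x by (simp add: l_distr)
    ultimately have "a \<otimes> x = \<zero>" "b \<otimes> x = \<zero>" using that by auto
    then have "(a, b) \<otimes>\<^bsub>R \<bowtie> I\<^esub> (x, x) = \<zero>\<^bsub>R \<bowtie> I\<^esub>" by (simp add: amalg_dup_simps)
    then show ?thesis
      using D.regularsD[OF s amalg_dup_mem(1)[OF I x]] by (simp add: amalg_dup_simps)
  qed
  show "a \<in> regulars R"
  proof (rule regularsI)
    fix x assume x: "x \<in> carrier R" "a \<otimes> x = \<zero>"
    have "x \<otimes> j = \<zero>" if j: "j \<in> I" for j
    proof -
      have "a \<otimes> (x \<otimes> j) = \<zero>" using x j by (simp add: m_assoc[symmetric])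
      then have "(a, b) \<otimes>\<^bsub>R \<bowtie> I\<^esub> (x \<otimes> j, \<zero>) = \<zero>\<^bsub>R \<bowtie> I\<^esub>" by (simp add: amalg_dup_simps)
      then show ?thesis
        using D.regularsD[OF s amalg_dup_mem(3)[OF I I.I_l_closed[OF j x(1)]]]
        by (simp add: amalg_dup_simps)
    qed
    then show "x = \<zero>" using ann x by blast
  qed simp
  show "b \<in> regulars R"
  proof (rule regularsI)
    fix x assume x: "x \<in> carrier R" "b \<otimes> x = \<zero>"
    have "x \<otimes> j = \<zero>" if j: "j \<in> I" for j
    proof -
      have "b \<otimes> (x \<otimes> j) = \<zero>" using x j by (simp add: m_assoc[symmetric])
      then have "(a, b) \<otimes>\<^bsub>R \<bowtie> I\<^esub> (\<zero>, x \<otimes> j) = \<zero>\<^bsub>R \<bowtie> I\<^esub>" by (simp add: amalg_dup_simps)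
      then show ?thesis
        using D.regularsD[OF s amalg_dup_mem(2)[OF I I.I_l_closed[OF j x(1)]]]
        by (simp add: amalg_dup_simps)
    qed
    then show "x = \<zero>" using ann x by blast
  qed simp
qed

text \<open>The diagonal supplies the lifts: \<open>(a, a)\<close> maps to \<open>a\<close>, and
  \<open>(t, t)\<close> is regular for regular \<open>t\<close> because multiplication is
  coordinatewise.\<close>

lemma amalg_dup_regular_surjection:
  assumes I: "ideal I R"
  shows "regular_surjection (R \<bowtie> I) R fst"
proof -
  interpret I: ideal I R by fact
  interpret D: cring "R \<bowtie> I" by (rule amalg_dup_is_cring[OF I])
  show ?thesis
  proof unfold_locales
    show "fst \<in> ring_hom (R \<bowtie> I) R"
      by (rule ring_hom_memI) (auto elim!: amalg_dup_carrierE simp: amalg_dup_simps)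
    show "fst ` carrier (R \<bowtie> I) = carrier R"
    proof (intro equalityI subsetI)
      show "a \<in> fst ` carrier (R \<bowtie> I)" if "a \<in> carrier R" for a
        using imageI[OF amalg_dup_mem(1)[OF I that], of fst] by simp
    qed (auto elim: amalg_dup_carrierE)
    show "fst s \<in> regulars R" if "s \<in> regulars (R \<bowtie> I)" for s
      by (rule amalg_dup_regular(1)[OF I, of _ "snd s"]) (simp add: that)
    show "\<exists>s \<in> regulars (R \<bowtie> I). fst s = t" if t: "t \<in> regulars R" for t
    proof
      show "(t, t) \<in> regulars (R \<bowtie> I)"
      proof (rule D.regularsI)
        show "(t, t) \<in> carrier (R \<bowtie> I)"
          using t by (intro amalg_dup_mem(1)[OF I] regulars_closed)
        fix p assume p: "p \<in> carrier (R \<bowtie> I)" "(t, t) \<otimes>\<^bsub>R \<bowtie> I\<^esub> p = \<zero>\<^bsub>R \<bowtie> I\<^esub>"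
        obtain a i where ai: "p = (a, a \<oplus> i)" "a \<in> carrier R" "i \<in> I"
          using p(1) by (rule amalg_dup_carrierE)
        have "a \<oplus> i \<in> carrier R" using ai(2,3) by simp
        then show "p = \<zero>\<^bsub>R \<bowtie> I\<^esub>"
          using p(2) ai(2) regularsD[OF t] unfolding ai(1) amalg_dup_simps by blast
      qed
    qed simp
  qed
qed

text \<open>For a regular \<open>(a, b)\<close> in \<open>L\<close>, divisibility is applied to the
  second coordinate: \<open>i = b j\<close> with \<open>j\<close> in \<open>I\<close> gives
  \<open>(0, i) = (a, b) (0, j)\<close>, an element of \<open>L\<close>.\<close>

lemma amalg_dup_kernel_subset:
  assumes I: "ideal I R" and divisible: "\<forall>a \<in> regulars R. I = a <# I"
    and L: "regular_ideal (R \<bowtie> I) L"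
  shows "a_kernel (R \<bowtie> I) R fst \<subseteq> L"
proof
  interpret I: ideal I R by fact
  interpret D: cring "R \<bowtie> I" by (rule amalg_dup_is_cring[OF I])
  obtain a b where ab: "(a, b) \<in> L" "(a, b) \<in> regulars (R \<bowtie> I)"
    using L by (auto simp: regular_ideal_def)
  interpret L: ideal L "R \<bowtie> I" using L by (simp add: regular_ideal_def)
  fix p assume "p \<in> a_kernel (R \<bowtie> I) R fst"
  then obtain i where p: "p = (\<zero>, i)" "i \<in> I"
    by (auto simp: a_kernel_def' elim!: amalg_dup_carrierE)
  have reg: "a \<in> regulars R" "b \<in> regulars R" using amalg_dup_regular[OF I ab(2)] .
  then obtain j where j: "j \<in> I" "i = b \<otimes> j"
    using p divisible unfolding l_coset_def by blast
  have "(a, b) \<otimes>\<^bsub>R \<bowtie> I\<^esub> (\<zero>, j) \<in> L"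
    using ab amalg_dup_mem(2)[OF I j(1)] by (intro L.I_r_closed)
  then show "p \<in> L" using p j reg by (simp add: amalg_dup_simps regulars_closed)
qed

end

theorem theorem2p12:
  fixes A :: "('a, 'm) ring_scheme" and I :: "'a set"
  assumes "cring A" and "\<one>\<^bsub>A\<^esub> \<noteq> \<zero>\<^bsub>A\<^esub>" and "ideal I A"
  shows "(isp_ring (A \<bowtie> I) \<longrightarrow> isp_ring A) \<and>
    ((\<forall>a \<in> regulars A. I = a <#\<^bsub>A\<^esub> I) \<longrightarrow> (isp_ring (A \<bowtie> I) \<longleftrightarrow> isp_ring A))"
proof -
  interpret cring A by fact
  interpret P: regular_surjection "A \<bowtie> I" A fst
    by (rule amalg_dup_regular_surjection[OF assms(3)])
  \<comment> \<open>Only this direction uses the divisibility of \<open>I\<close>; the other one is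
    \<open>P.isp_ring_img\<close>.\<close>
  have "isp_ring (A \<bowtie> I)" if "\<forall>a \<in> regulars A. I = a <#\<^bsub>A\<^esub> I" "isp_ring A"
    using P.isp_ring_pre[OF amalg_dup_kernel_subset[OF assms(3) that(1)]] that(2) by blast
  then show ?thesis using P.isp_ring_img assms(2) by blast
qed

end
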